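(* Let $I\subset\mathbb R$ be an open interval equipped with a Riemannian metric $g=w(x)\,dx^2$, $w>0$ smooth, and an affine connection $\nabla$ such that the coordinate $x$ is $\nabla$-affine (i.e. $\nabla_{\partial_x}\partial_x=0$), so that $A(x_1,x_2)=\frac{x_1+x_2}{2}$. Let $M$ and $M_g$ be the midpoint means of the $g$-dual connection $\nabla^*$ and of the Levi--Civita connection $\nabla^g$. Then the following are equivalent: (a) $M_g(A(P,Q),M(P,Q))=M_g(P,Q)$ for all $P,Q\in I$; (b) $A\otimes M=M_g$ on $I\times I$ (the Gauss composition being well defined because $A$ and $M$ are continuous strict means on an interval); (c) either $w$ is constant on $I$, in which case $\nabla=\nabla^g$ and $A=M=M_g$; or $$w(x)=\frac{c}{(x-x_0)^2}$$ for some $c>0$ and $x_0\in\mathbb R\setminus I$. In the second case of (c), the affine change $y=\pm(x-x_0)$ (with the appropriate sign) maps $I$ into $(0,\infty)$, and in the coordinate $y$ $$A(y_1,y_2)=\frac{y_1+y_2}{2},\qquad M(y_1,y_2)=\frac{2}{y_1^{-1}+y_2^{-1}},\qquad M_g(y_1,y_2)=\sqrt{y_1y_2}.$$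
   Context: The $g$-dual $\nabla^*$ of $\nabla$ is determined by $X[g(Y,Z)]=g(\nabla_XY,Z)+g(Y,\nabla^*_XZ)$. The midpoint mean of a connection $D$ on $I$ is $M_D(P,Q)=\gamma(1/2)$, where $\gamma:[0,1]\to I$ is the unique affinely parametrized $D$-geodesic from $P$ to $Q$; $A=M_\nabla$, $M=M_{\nabla^*}$, $M_g=M_{\nabla^g}$. (In dimension one such geodesics always exist and are unique.) Gauss composition: put $(P_0,Q_0)=(P,Q)$, $(P_{n+1},Q_{n+1})=(A(P_n,Q_n),M(P_n,Q_n))$; $(A\otimes M)(P,Q)$ is the common limit of the two sequences. A mean $N$ on $I$ is strict if $\min\{P,Q\}<N(P,Q)<\max\{P,Q\}$ for $P\ne Q$. *)

theory Defs
  imports "HOL-Analysis.Analysis"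
begin

(* Throughout, I is a nonempty open interval with its standard coordinate x.  A function
   X :: real => real that is smooth on I stands for the vector field X d/dx on I; values
   outside I are irrelevant, so vector fields and connections are only compared on I. *)

definition smooth_fun_on :: "real set \<Rightarrow> (real \<Rightarrow> real) \<Rightarrow> bool" where
  "smooth_fun_on I f \<longleftrightarrow> (\<forall>n. \<forall>x\<in>I. ((deriv ^^ n) f) field_differentiable (at x))"

type_synonym connection = "(real \<Rightarrow> real) \<Rightarrow> (real \<Rightarrow> real) \<Rightarrow> (real \<Rightarrow> real)"

definition affine_connection :: "real set \<Rightarrow> connection \<Rightarrow> bool" where
  "affine_connection I D \<longleftrightarrow>
     (\<forall>X Y. smooth_fun_on I X \<longrightarrow> smooth_fun_on I Y \<longrightarrow> smooth_fun_on I (D X Y)) \<and>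
     (\<forall>f X h X' Y. smooth_fun_on I f \<longrightarrow> smooth_fun_on I X \<longrightarrow> smooth_fun_on I h \<longrightarrow>
        smooth_fun_on I X' \<longrightarrow> smooth_fun_on I Y \<longrightarrow>
        (\<forall>x\<in>I. D (\<lambda>u. f u * X u + h u * X' u) Y x = f x * D X Y x + h x * D X' Y x)) \<and>
     (\<forall>X Y Y'. smooth_fun_on I X \<longrightarrow> smooth_fun_on I Y \<longrightarrow> smooth_fun_on I Y' \<longrightarrow>
        (\<forall>x\<in>I. D X (\<lambda>u. Y u + Y' u) x = D X Y x + D X Y' x)) \<and>
     (\<forall>f X Y. smooth_fun_on I f \<longrightarrow> smooth_fun_on I X \<longrightarrow> smooth_fun_on I Y \<longrightarrow>
        (\<forall>x\<in>I. D X (\<lambda>u. f u * Y u) x = X x * deriv f x * Y x + f x * D X Y x))"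

definition connections_agree_on :: "real set \<Rightarrow> connection \<Rightarrow> connection \<Rightarrow> bool" where
  "connections_agree_on I D D' \<longleftrightarrow>
     (\<forall>X Y. smooth_fun_on I X \<longrightarrow> smooth_fun_on I Y \<longrightarrow> (\<forall>x\<in>I. D X Y x = D' X Y x))"

definition riemannian_metric :: "real set \<Rightarrow> (real \<Rightarrow> real) \<Rightarrow> bool" where
  "riemannian_metric I w \<longleftrightarrow> smooth_fun_on I w \<and> (\<forall>x\<in>I. 0 < w x)"

(* g(X,Y) for the metric g = w dx^2 *)
definition metric_pairing :: "(real \<Rightarrow> real) \<Rightarrow> (real \<Rightarrow> real) \<Rightarrow> (real \<Rightarrow> real) \<Rightarrow> (real \<Rightarrow> real)" where
  "metric_pairing w X Y = (\<lambda>x. w x * X x * Y x)"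

(* D' is the g-dual of D:  X[g(Y,Z)] = g(D_X Y, Z) + g(Y, D'_X Z) *)
definition dual_connection :: "real set \<Rightarrow> (real \<Rightarrow> real) \<Rightarrow> connection \<Rightarrow> connection \<Rightarrow> bool" where
  "dual_connection I w D D' \<longleftrightarrow> affine_connection I D' \<and>
     (\<forall>X Y Z. smooth_fun_on I X \<longrightarrow> smooth_fun_on I Y \<longrightarrow> smooth_fun_on I Z \<longrightarrow>
        (\<forall>x\<in>I. X x * deriv (metric_pairing w Y Z) x =
           metric_pairing w (D X Y) Z x + metric_pairing w Y (D' X Z) x))"

definition lie_bracket :: "(real \<Rightarrow> real) \<Rightarrow> (real \<Rightarrow> real) \<Rightarrow> (real \<Rightarrow> real)" where
  "lie_bracket X Y = (\<lambda>x. X x * deriv Y x - Y x * deriv X x)"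

(* Metric compatibility is self-duality with respect to g. *)
definition levi_civita_connection :: "real set \<Rightarrow> (real \<Rightarrow> real) \<Rightarrow> connection \<Rightarrow> bool" where
  "levi_civita_connection I w D \<longleftrightarrow> dual_connection I w D D \<and>
     (\<forall>X Y. smooth_fun_on I X \<longrightarrow> smooth_fun_on I Y \<longrightarrow>
        (\<forall>x\<in>I. D X Y x - D Y X x = lie_bracket X Y x))"

(* D_{d/dx} d/dx = (christoffel D) d/dx *)
definition christoffel :: "connection \<Rightarrow> real \<Rightarrow> real" where
  "christoffel D = D (\<lambda>_. 1) (\<lambda>_. 1)"

(* The equation is the coordinate form of D_{c'} c' = 0 along the curve c; since the
   Christoffel symbol is smooth on I, its C^2 solutions are automatically smooth. *)
definition affine_geodesic :: "real set \<Rightarrow> connection \<Rightarrow> (real \<Rightarrow> real) \<Rightarrow> bool" where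
  "affine_geodesic I D c \<longleftrightarrow>
     (\<exists>v a. \<forall>t\<in>{0..1}. c t \<in> I \<and>
        (c has_real_derivative v t) (at t within {0..1}) \<and>
        (v has_real_derivative a t) (at t within {0..1}) \<and>
        a t + christoffel D (c t) * (v t)\<^sup>2 = 0)"

(* The geodesic is unique only as a function on [0,1], hence the description of the
   midpoint rather than of the curve. *)
definition midpoint_mean :: "real set \<Rightarrow> connection \<Rightarrow> real \<Rightarrow> real \<Rightarrow> real" where
  "midpoint_mean I D P Q =
     (THE m. \<exists>c. affine_geodesic I D c \<and> c 0 = P \<and> c 1 = Q \<and> m = c (1/2))"

definition strict_mean_on :: "real set \<Rightarrow> (real \<Rightarrow> real \<Rightarrow> real) \<Rightarrow> bool" where
  "strict_mean_on I N \<longleftrightarrow>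
     (\<forall>P\<in>I. \<forall>Q\<in>I. min P Q \<le> N P Q \<and> N P Q \<le> max P Q) \<and>
     (\<forall>P\<in>I. \<forall>Q\<in>I. P \<noteq> Q \<longrightarrow> min P Q < N P Q \<and> N P Q < max P Q)"

definition continuous_mean_on :: "real set \<Rightarrow> (real \<Rightarrow> real \<Rightarrow> real) \<Rightarrow> bool" where
  "continuous_mean_on I N \<longleftrightarrow> continuous_on (I \<times> I) (\<lambda>(P, Q). N P Q)"

primrec gauss_seq ::
  "(real \<Rightarrow> real \<Rightarrow> real) \<Rightarrow> (real \<Rightarrow> real \<Rightarrow> real) \<Rightarrow> real \<Rightarrow> real \<Rightarrow> nat \<Rightarrow> real \<times> real" where
  "gauss_seq A M P Q 0 = (P, Q)"
| "gauss_seq A M P Q (Suc n) =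
     (A (fst (gauss_seq A M P Q n)) (snd (gauss_seq A M P Q n)),
      M (fst (gauss_seq A M P Q n)) (snd (gauss_seq A M P Q n)))"

definition gauss_common_limit ::
  "(real \<Rightarrow> real \<Rightarrow> real) \<Rightarrow> (real \<Rightarrow> real \<Rightarrow> real) \<Rightarrow> real \<Rightarrow> real \<Rightarrow> real \<Rightarrow> bool" where
  "gauss_common_limit A M P Q L \<longleftrightarrow>
     (\<lambda>n. fst (gauss_seq A M P Q n)) \<longlonglongrightarrow> L \<and> (\<lambda>n. snd (gauss_seq A M P Q n)) \<longlonglongrightarrow> L"

definition gauss_composition ::
  "(real \<Rightarrow> real \<Rightarrow> real) \<Rightarrow> (real \<Rightarrow> real \<Rightarrow> real) \<Rightarrow> real \<Rightarrow> real \<Rightarrow> real" where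
  "gauss_composition A M P Q = (THE L. gauss_common_limit A M P Q L)"

end

theory Submission
  imports Defs
begin

text \<open>
  On an interval a connection is a single Christoffel symbol \<open>\<Gamma>\<close>. If \<open>\<phi>' > 0\<close> and
  \<open>\<phi>'' = \<Gamma> \<phi>'\<close>, then \<open>\<phi>\<close> is a coordinate in which the geodesics are the affine functions, so the
  midpoint mean is the quasi-arithmetic mean \<open>\<phi>\<^sup>-\<^sup>1 ((\<phi> P + \<phi> Q) / 2)\<close>
  (\<open>midpoint_mean_quasi_arithmetic\<close>). Evaluating the duality equation on the coordinate field
  gives \<open>w' = w (\<Gamma> + \<Gamma>\<^sup>*)\<close>, hence \<open>\<Gamma> = 0\<close>, \<open>\<Gamma>\<^sup>* = w'/w\<close> and \<open>\<Gamma>\<^sup>g = w'/(2w)\<close>; the three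
  means are generated by \<open>x\<close>, by an antiderivative \<open>u\<close> of \<open>w\<close>, and by an antiderivative \<open>s\<close>
  of \<open>sqrt w\<close>.

  The equivalence of (a) and (b) is the usual invariance principle: a continuous mean is
  constant along every Gauss iteration iff it computes the common limit. The common limit exists
  because the larger and smaller entries form monotone bounded sequences, so the arithmetic
  mean of the two entries converges; this mean is the first entry one step later, and the second
  entry is a linear combination of two successive first entries.

  The core is that (a) implies (c). Write \<open>r = sqrt w\<close>. Invariance says
  \<open>s(A) + s(M) = s(P) + s(Q)\<close> with \<open>A = (P+Q)/2\<close> and \<open>2 u(M) = u(P) + u(Q)\<close>. Its derivatives in
  \<open>P\<close> and \<open>Q\<close> are
  \<open>r(A)/2 + r(P)\<^sup>2/(2 r(M)) = r(P)\<close> and \<open>r(A)/2 + r(Q)\<^sup>2/(2 r(M)) = r(Q)\<close>.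
  If \<open>r(P) \<noteq> r(Q)\<close>, subtracting yields \<open>2 r(M) = r(P) + r(Q)\<close>, and then \<open>r(A)\<close> is the harmonic
  mean of \<open>r(P)\<close> and \<open>r(Q)\<close>. Thus \<open>1/r\<close> satisfies the midpoint equation at all pairs where
  its values differ, and that suffices to make it affine (\<open>conditional_midpoint_affine\<close>).
  So \<open>w = 1/(\<alpha> x + \<beta>)\<^sup>2\<close>, which is constant or an inverse square.

  Conversely, for constant \<open>w\<close> all three means are arithmetic, and for an inverse square they
  are, in the coordinate \<open>y\<close>, the arithmetic, harmonic and geometric means, whose
  invariance is the identity \<open>A M = P Q\<close>.
\<close>

section \<open>Affine coordinates and quasi-arithmetic means\<close>

text \<open>
  An open interval of reals, bounded or not, is the set of reals between two extended reals;
  in that form the fundamental theorem of calculus gives an antiderivative on all of it.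
\<close>

lemma antiderivative_on_open_interval:
  fixes f :: "real \<Rightarrow> real"
  assumes I: "open I" "is_interval I" and cont: "\<And>x. x \<in> I \<Longrightarrow> isCont f x"
  shows "\<exists>F. \<forall>x\<in>I. (F has_real_derivative f x) (at x)"
proof (cases "I = {}")
  case False
  define a where "a = Inf (ereal ` I)"
  define b where "b = Sup (ereal ` I)"
  have iff: "x \<in> I \<longleftrightarrow> a < ereal x \<and> ereal x < b" for x
  proof
    assume x: "x \<in> I"
    then obtain e where e: "e > 0" "cball x e \<subseteq> I"
      using I(1) open_contains_cball by blast
    have "x - e \<in> I" "x + e \<in> I"
      using e by (auto simp: subset_iff dist_real_def)
    then have "a \<le> ereal (x - e)" "ereal (x + e) \<le> b"
      unfolding a_def b_def by (auto intro: Inf_lower Sup_upper)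
    moreover have "ereal (x - e) < ereal x" "ereal x < ereal (x + e)"
      using e by auto
    ultimately show "a < ereal x \<and> ereal x < b"
      by (metis order.strict_trans1 order.strict_trans2)
  next
    assume "a < ereal x \<and> ereal x < b"
    then obtain y z where "y \<in> I" "z \<in> I" "y < x" "x < z"
      unfolding a_def b_def by (auto simp: Inf_less_iff less_Sup_iff)
    then show "x \<in> I"
      using I(2) unfolding is_interval_1 by (meson less_imp_le)
  qed
  have "a < b"
    using False iff by (meson ex_in_conv order.strict_trans)
  then have "\<exists>F. \<forall>x::real. a < x \<longrightarrow> x < b \<longrightarrow> (F has_vector_derivative f x) (at x)"
    by (intro einterval_antiderivative) (use iff cont in auto)
  then show ?thesis
    using iff by (auto simp: has_real_derivative_iff_has_vector_derivative)
qed auto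

definition quasi_arithmetic_on :: "real set \<Rightarrow> (real \<Rightarrow> real) \<Rightarrow> (real \<Rightarrow> real \<Rightarrow> real) \<Rightarrow> bool" where
  "quasi_arithmetic_on I \<phi> N \<longleftrightarrow>
     (\<forall>P\<in>I. \<forall>Q\<in>I. N P Q \<in> I \<and> \<phi> (N P Q) = (\<phi> P + \<phi> Q) / 2)"

text \<open>
  The last condition is the transformation law of Christoffel symbols: it says that the symbol of
  \<open>D\<close> vanishes in the coordinate \<open>\<phi>\<close>. The derivative \<open>\<psi>\<close> is a parameter because its own
  derivative is needed.
\<close>

definition affine_coordinate :: "real set \<Rightarrow> connection \<Rightarrow> (real \<Rightarrow> real) \<Rightarrow> (real \<Rightarrow> real) \<Rightarrow> bool" where
  "affine_coordinate I D \<phi> \<psi> \<longleftrightarrow>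
     (\<forall>x\<in>I. (\<phi> has_real_derivative \<psi> x) (at x) \<and> 0 < \<psi> x \<and>
        (\<psi> has_real_derivative christoffel D x * \<psi> x) (at x))"

lemma pos_deriv_strict_mono_on:
  fixes \<phi> :: "real \<Rightarrow> real"
  assumes "is_interval I" and "\<And>x. x \<in> I \<Longrightarrow> (\<phi> has_real_derivative \<psi> x) (at x)"
    and "\<And>x. x \<in> I \<Longrightarrow> 0 < \<psi> x"
  shows "strict_mono_on I \<phi>"
proof (rule strict_mono_onI)
  fix x y assume xy: "x \<in> I" "y \<in> I" "x < y"
  show "\<phi> x < \<phi> y"
  proof (rule DERIV_pos_imp_increasing[OF xy(3)])
    fix z assume "x \<le> z" "z \<le> y"
    then have "z \<in> I"
      using assms(1) xy unfolding is_interval_1 by blast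
    then show "\<exists>d. (\<phi> has_real_derivative d) (at z) \<and> 0 < d"
      using assms by blast
  qed
qed

lemma inv_into_has_derivative:
  fixes \<phi> :: "real \<Rightarrow> real"
  assumes "open I" "is_interval I" and d: "\<And>x. x \<in> I \<Longrightarrow> (\<phi> has_real_derivative \<psi> x) (at x)"
    and pos: "\<And>x. x \<in> I \<Longrightarrow> 0 < \<psi> x" and x: "x \<in> I"
  shows "(inv_into I \<phi> has_real_derivative inverse (\<psi> x)) (at (\<phi> x))"
  unfolding has_field_derivative_def
proof (rule has_derivative_inverse_strong[OF assms(1) x])
  show "continuous_on I \<phi>"
    using d DERIV_isCont continuous_at_imp_continuous_on by blast
  have "inj_on \<phi> I"
    using pos_deriv_strict_mono_on[OF assms(2) d pos] strict_mono_on_imp_inj_on by blast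
  then show "\<And>z. z \<in> I \<Longrightarrow> inv_into I \<phi> (\<phi> z) = z" by simp
  show "(\<phi> has_derivative (*) (\<psi> x)) (at x)"
    using d[OF x] unfolding has_field_derivative_def .
  show "(*) (\<psi> x) \<circ> (*) (inverse (\<psi> x)) = id"
    using pos[OF x] by (auto simp: fun_eq_iff)
qed

lemma affine_combination_in_image:
  fixes \<phi> :: "real \<Rightarrow> real"
  assumes "is_interval I" "continuous_on I \<phi>" "P \<in> I" "Q \<in> I" "0 \<le> t" "t \<le> 1"
  shows "(1 - t) * \<phi> P + t * \<phi> Q \<in> \<phi> ` I"
proof -
  have "convex (\<phi> ` I)"
    using assms(1,2) connected_continuous_image is_interval_connected_1 is_interval_convex_1 by metis
  then show ?thesis
    using assms(3-) unfolding convex_alt by auto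
qed

text \<open>
  The geodesic equation says exactly that the velocity \<open>\<psi>(c) c'\<close> of \<open>\<phi> \<circ> c\<close> is constant.
  Since \<open>\<phi>\<close> is injective, this is where uniqueness of geodesics comes from.
\<close>

lemma geodesic_affine_in_coordinate:
  assumes co: "affine_coordinate I D \<phi> \<psi>" and geo: "affine_geodesic I D c" and t: "t \<in> {0..1}"
  shows "\<phi> (c t) = (1 - t) * \<phi> (c 0) + t * \<phi> (c 1)"
proof -
  obtain v a where va: "\<And>t. t \<in> {0..1} \<Longrightarrow> c t \<in> I"
      "\<And>t. t \<in> {0..1} \<Longrightarrow> (c has_real_derivative v t) (at t within {0..1})"
      "\<And>t. t \<in> {0..1} \<Longrightarrow> (v has_real_derivative a t) (at t within {0..1})"
      "\<And>t. t \<in> {0..1} \<Longrightarrow> a t + christoffel D (c t) * (v t)\<^sup>2 = 0"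
    using geo unfolding affine_geodesic_def by metis
  have \<phi>c: "((\<lambda>t. \<phi> (c t)) has_real_derivative \<psi> (c t) * v t) (at t within {0..1})"
    if "t \<in> {0..1}" for t
    using DERIV_chain2[of \<phi> "\<psi> (c t)" c t "v t"] co va(1,2)[OF that]
    unfolding affine_coordinate_def by blast
  have "((\<lambda>t. \<psi> (c t) * v t) has_real_derivative 0) (at t within {0..1})"
    if "t \<in> {0..1}" for t
  proof -
    have "((\<lambda>t. \<psi> (c t)) has_real_derivative (christoffel D (c t) * \<psi> (c t)) * v t) (at t within {0..1})"
      using DERIV_chain2[of \<psi> "christoffel D (c t) * \<psi> (c t)" c t "v t"] co va(1,2)[OF that]
      unfolding affine_coordinate_def by blast
    from DERIV_mult[OF this va(3)[OF that]]
    have "((\<lambda>t. \<psi> (c t) * v t) has_real_derivative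
        \<psi> (c t) * (a t + christoffel D (c t) * (v t)\<^sup>2)) (at t within {0..1})"
      by (simp add: algebra_simps power2_eq_square)
    then show ?thesis using va(4)[OF that] by simp
  qed
  then obtain k where k: "\<And>t. t \<in> {0..1} \<Longrightarrow> \<psi> (c t) * v t = k"
    using has_field_derivative_zero_constant[of "{0..1::real}" "\<lambda>t. \<psi> (c t) * v t"] by auto
  have "((\<lambda>t. \<phi> (c t) - t * k) has_real_derivative 0) (at t within {0..1})"
    if "t \<in> {0..1}" for t
    using \<phi>c[OF that] k[OF that] by (auto intro!: derivative_eq_intros)
  then obtain m where m: "\<And>t. t \<in> {0..1} \<Longrightarrow> \<phi> (c t) - t * k = m"
    using has_field_derivative_zero_constant[of "{0..1::real}" "\<lambda>t. \<phi> (c t) - t * k"] by auto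
  show ?thesis
    using m[OF t] m[of 0] m[of 1] by (simp add: algebra_simps)
qed

text \<open>
  Existence: the segment from \<open>\<phi> P\<close> to \<open>\<phi> Q\<close> stays inside the interval \<open>\<phi> ` I\<close> and can be
  pulled back by the inverse of \<open>\<phi>\<close>.
\<close>

lemma geodesic_exists:
  assumes I: "open I" "is_interval I" and co: "affine_coordinate I D \<phi> \<psi>"
    and P: "P \<in> I" and Q: "Q \<in> I"
  shows "\<exists>c. affine_geodesic I D c \<and> c 0 = P \<and> c 1 = Q"
proof -
  have d: "\<And>x. x \<in> I \<Longrightarrow> (\<phi> has_real_derivative \<psi> x) (at x)"
    and pos: "\<And>x. x \<in> I \<Longrightarrow> 0 < \<psi> x"
    and d2: "\<And>x. x \<in> I \<Longrightarrow> (\<psi> has_real_derivative christoffel D x * \<psi> x) (at x)"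
    using co unfolding affine_coordinate_def by auto
  have cont: "continuous_on I \<phi>"
    using d DERIV_isCont continuous_at_imp_continuous_on by blast
  have inj: "inj_on \<phi> I"
    using pos_deriv_strict_mono_on[OF I(2) d pos] strict_mono_on_imp_inj_on by blast
  define k where "k = \<phi> Q - \<phi> P"
  define L where "L t = (1 - t) * \<phi> P + t * \<phi> Q" for t
  define c where "c t = inv_into I \<phi> (L t)" for t
  have Lim: "L t \<in> \<phi> ` I" if "t \<in> {0..1}" for t
    unfolding L_def using affine_combination_in_image[OF I(2) cont P Q] that by simp
  have cI: "c t \<in> I" and \<phi>c: "\<phi> (c t) = L t" if "t \<in> {0..1}" for t
    unfolding c_def using Lim[OF that] by (auto intro: inv_into_into f_inv_into_f)
  have dL: "(L has_real_derivative k) (at t within {0..1})" for t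
    unfolding L_def k_def by (auto intro!: derivative_eq_intros)
  have dc: "(c has_real_derivative k / \<psi> (c t)) (at t within {0..1})" if "t \<in> {0..1}" for t
  proof -
    have "(inv_into I \<phi> has_real_derivative inverse (\<psi> (c t))) (at (L t))"
      using inv_into_has_derivative[OF I d pos cI[OF that]] \<phi>c[OF that] by simp
    from DERIV_chain2[OF this dL] show ?thesis
      unfolding c_def by (simp add: field_simps)
  qed
  have dv: "((\<lambda>t. k / \<psi> (c t)) has_real_derivative - (christoffel D (c t) * (k / \<psi> (c t))\<^sup>2)) (at t within {0..1})"
    if "t \<in> {0..1}" for t
  proof -
    have nz: "\<psi> (c t) \<noteq> 0" using pos[OF cI[OF that]] by simp
    have "((\<lambda>t. \<psi> (c t)) has_real_derivative (christoffel D (c t) * \<psi> (c t)) * (k / \<psi> (c t))) (at t within {0..1})"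
      using DERIV_chain2[OF d2[OF cI[OF that]] dc[OF that]] .
    then show ?thesis using nz
      by (auto intro!: derivative_eq_intros simp: power2_eq_square field_simps)
  qed
  have "affine_geodesic I D c"
    unfolding affine_geodesic_def
    by (intro exI[of _ "\<lambda>t. k / \<psi> (c t)"] exI[of _ "\<lambda>t. - (christoffel D (c t) * (k / \<psi> (c t))\<^sup>2)"])
      (use cI dc dv in auto)
  moreover have "c 0 = P" "c 1 = Q"
    unfolding c_def L_def using inj P Q by auto
  ultimately show ?thesis by blast
qed

lemma midpoint_mean_quasi_arithmetic:
  assumes I: "open I" "is_interval I" and co: "affine_coordinate I D \<phi> \<psi>"
  shows "quasi_arithmetic_on I \<phi> (midpoint_mean I D)"
  unfolding quasi_arithmetic_on_def
proof (intro ballI)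
  fix P Q assume PQ: "P \<in> I" "Q \<in> I"
  have inj: "inj_on \<phi> I"
    using pos_deriv_strict_mono_on[OF I(2)] strict_mono_on_imp_inj_on co
    unfolding affine_coordinate_def by blast
  let ?mid = "\<lambda>m. \<exists>c. affine_geodesic I D c \<and> c 0 = P \<and> c 1 = Q \<and> m = c (1/2)"
  have mid: "m \<in> I \<and> \<phi> m = (\<phi> P + \<phi> Q) / 2" if m: "?mid m" for m
  proof -
    obtain c where c: "affine_geodesic I D c" "c 0 = P" "c 1 = Q" "m = c (1/2)"
      using m by blast
    have "c (1/2) \<in> I"
      using c(1) unfolding affine_geodesic_def by force
    moreover have "\<phi> (c (1/2)) = (\<phi> P + \<phi> Q) / 2"
      using geodesic_affine_in_coordinate[OF co c(1), of "1/2"] c by (simp add: field_simps)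
    ultimately show ?thesis using c by simp
  qed
  obtain m where m: "?mid m"
    using geodesic_exists[OF I co PQ] by blast
  have "?mid (midpoint_mean I D P Q)"
    unfolding midpoint_mean_def
  proof (rule theI[of ?mid])
    show "?mid m" by (fact m)
    show "m' = m" if "?mid m'" for m'
      using mid[OF that] mid[OF m] inj by (metis inj_on_eq_iff)
  qed
  then show "midpoint_mean I D P Q \<in> I \<and> \<phi> (midpoint_mean I D P Q) = (\<phi> P + \<phi> Q) / 2"
    by (rule mid)
qed

lemma quasi_arithmetic_strict:
  assumes mono: "strict_mono_on I \<phi>" and N: "quasi_arithmetic_on I \<phi> N"
  shows "strict_mean_on I N"
proof -
  have N': "N P Q \<in> I" "\<phi> (N P Q) = (\<phi> P + \<phi> Q) / 2" if "P \<in> I" "Q \<in> I" for P Q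
    using N that unfolding quasi_arithmetic_on_def by auto
  have less: "x < y" if "\<phi> x < \<phi> y" "x \<in> I" "y \<in> I" for x y
    using strict_mono_on_less[OF mono] that by blast
  have lt: "P < N P Q \<and> N P Q < Q \<and> P < N Q P \<and> N Q P < Q" if "P \<in> I" "Q \<in> I" "P < Q" for P Q
  proof -
    have "\<phi> P < \<phi> Q" using mono that by (simp add: strict_mono_onD)
    then show ?thesis
      using N'[of P Q] N'[of Q P] that less[of P "N P Q"] less[of "N P Q" Q] less[of P "N Q P"]
        less[of "N Q P" Q] by simp
  qed
  have eq: "N P P = P" if "P \<in> I" for P
    using N'[OF that that] strict_mono_on_imp_inj_on[OF mono] that
    by (metis field_sum_of_halves add_divide_distrib inj_on_eq_iff)
  have strict: "min P Q < N P Q \<and> N P Q < max P Q" if "P \<in> I" "Q \<in> I" "P \<noteq> Q" for P Q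
    using lt[of P Q] lt[of Q P] that by (cases "P < Q") auto
  then show ?thesis
    unfolding strict_mean_on_def using eq
    by (metis less_imp_le max.idem min.idem order_refl)
qed

lemma quasi_arithmetic_continuous:
  assumes I: "open I" "is_interval I" and d: "\<And>x. x \<in> I \<Longrightarrow> (\<phi> has_real_derivative \<psi> x) (at x)"
    and pos: "\<And>x. x \<in> I \<Longrightarrow> 0 < \<psi> x" and N: "quasi_arithmetic_on I \<phi> N"
  shows "continuous_mean_on I N"
proof -
  have inj: "inj_on \<phi> I"
    using pos_deriv_strict_mono_on[OF I(2) d pos] strict_mono_on_imp_inj_on by blast
  have cont: "continuous_on I \<phi>"
    using d DERIV_isCont continuous_at_imp_continuous_on by blast
  have c_inv: "continuous_on (\<phi> ` I) (inv_into I \<phi>)"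
    using inv_into_has_derivative[OF I d pos] DERIV_isCont
    by (intro continuous_at_imp_continuous_on) blast
  have N': "N P Q \<in> I" "\<phi> (N P Q) = (\<phi> P + \<phi> Q) / 2" if "P \<in> I" "Q \<in> I" for P Q
    using N that unfolding quasi_arithmetic_on_def by auto
  have eq: "N P Q = inv_into I \<phi> ((\<phi> P + \<phi> Q) / 2)" if "P \<in> I" "Q \<in> I" for P Q
    using N'[OF that] inj by (metis inv_into_f_f)
  have "continuous_on (I \<times> I) (\<lambda>z. inv_into I \<phi> ((\<phi> (fst z) + \<phi> (snd z)) / 2))"
  proof (rule continuous_on_compose2[OF c_inv])
    show "continuous_on (I \<times> I) (\<lambda>z. (\<phi> (fst z) + \<phi> (snd z)) / 2)"
      by (intro continuous_intros continuous_on_compose2[OF cont]) auto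
    show "(\<lambda>z. (\<phi> (fst z) + \<phi> (snd z)) / 2) ` (I \<times> I) \<subseteq> \<phi> ` I"
      using N' by (auto simp: image_iff) (metis)
  qed
  then show ?thesis
    unfolding continuous_mean_on_def
    by (rule continuous_on_eq) (auto simp: eq)
qed

section \<open>Gauss composition with the arithmetic mean\<close>

lemma gauss_seq_shift:
  "gauss_seq A M (A P Q) (M P Q) n = gauss_seq A M P Q (Suc n)"
  by (induction n) auto

text \<open>
  The minima of the two entries increase and their maxima decrease. The sum of the entries is
  the sum of these two convergent sequences, and half of it is the next first entry; so the first
  entries converge, and the second entries with them.
\<close>

lemma gauss_common_limit_arithmetic:
  assumes I: "is_interval I" and A: "\<And>P Q. P \<in> I \<Longrightarrow> Q \<in> I \<Longrightarrow> A P Q = (P + Q) / 2"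
    and M: "strict_mean_on I M" and P: "P \<in> I" and Q: "Q \<in> I"
  shows "\<exists>L\<in>I. gauss_common_limit A M P Q L"
    and "\<And>n. fst (gauss_seq A M P Q n) \<in> I \<and> snd (gauss_seq A M P Q n) \<in> I"
proof -
  define p where "p n = fst (gauss_seq A M P Q n)" for n
  define q where "q n = snd (gauss_seq A M P Q n)" for n
  define lo where "lo n = min (p n) (q n)" for n
  define hi where "hi n = max (p n) (q n)" for n
  have Mm: "min x y \<le> M x y \<and> M x y \<le> max x y" if "x \<in> I" "y \<in> I" for x y
    using M that unfolding strict_mean_on_def by blast
  have between: "z \<in> I" if "x \<in> I" "y \<in> I" "min x y \<le> z" "z \<le> max x y" for x y z
    using I that unfolding is_interval_1 by (metis max_def min_def)
  have suc: "p (Suc n) = A (p n) (q n)" "q (Suc n) = M (p n) (q n)" for n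
    unfolding p_def q_def by auto
  have inI: "p n \<in> I \<and> q n \<in> I" for n
  proof (induction n)
    case 0 then show ?case using P Q by (simp add: p_def q_def)
  next
    case (Suc n)
    show ?case unfolding suc
      using Suc between[of "p n" "q n" "A (p n) (q n)"] between[of "p n" "q n" "M (p n) (q n)"]
        Mm[of "p n" "q n"] by (auto simp: A)
  qed
  then show "fst (gauss_seq A M P Q n) \<in> I \<and> snd (gauss_seq A M P Q n) \<in> I" for n
    unfolding p_def q_def .
  have pS: "p (Suc n) = (lo n + hi n) / 2" for n
    unfolding lo_def hi_def suc using A inI by (simp add: min_def max_def)
  have step: "lo n \<le> lo (Suc n) \<and> hi (Suc n) \<le> hi n \<and> lo n \<le> hi n" for n
    using Mm[of "p n" "q n"] A[of "p n" "q n"] inI[of n]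
    unfolding lo_def hi_def suc by (auto simp: min_def max_def)
  have inc: "incseq lo" and dec: "decseq hi" and le: "lo n \<le> hi n" for n
    using step by (auto intro: incseq_SucI decseq_SucI)
  have "lo n \<le> hi 0" "lo 0 \<le> hi n" for n
    using le[of n] incseqD[OF inc, of 0 n] decseqD[OF dec, of 0 n] by auto
  then obtain l h where l: "lo \<longlonglongrightarrow> l" "lo 0 \<le> l" and h: "hi \<longlonglongrightarrow> h" "h \<le> hi 0"
    using incseq_convergent[OF inc, of "hi 0"] decseq_convergent[OF dec, of "lo 0"]
    by (metis decseq_ge incseq_le dec inc le0)
  have "(\<lambda>n. p (Suc n)) \<longlonglongrightarrow> (l + h) / 2"
    unfolding pS by (intro tendsto_intros l h) auto
  then have p: "p \<longlonglongrightarrow> (l + h) / 2"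
    by (rule LIMSEQ_imp_Suc)
  \<comment> \<open>Since \<open>p (Suc n)\<close> is the average of \<open>p n\<close> and \<open>q n\<close>, the limit of \<open>p\<close> determines that of \<open>q\<close>.\<close>
  have "q n = 2 * p (Suc n) - p n" for n
    using A[of "p n" "q n"] inI[of n] by (simp add: suc field_simps)
  then have "q = (\<lambda>n. 2 * p (Suc n) - p n)" by (rule ext)
  moreover have "(\<lambda>n. 2 * p (Suc n) - p n) \<longlonglongrightarrow> 2 * ((l + h) / 2) - (l + h) / 2"
    by (intro tendsto_intros p LIMSEQ_Suc)
  moreover have "2 * ((l + h) / 2) - (l + h) / 2 = (l + h) / 2"
    by (simp add: field_simps)
  ultimately have q: "q \<longlonglongrightarrow> (l + h) / 2" by metis
  have "l \<le> h" using LIMSEQ_le[OF l(1) h(1)] le by blast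
  then have "(l + h) / 2 \<in> I"
    using between[OF P Q, of "(l + h) / 2"] l(2) h(2) unfolding lo_def hi_def p_def q_def by auto
  then show "\<exists>L\<in>I. gauss_common_limit A M P Q L"
    using p q unfolding gauss_common_limit_def p_def[abs_def] q_def[abs_def] by auto
qed

lemma gauss_composition_eqI:
  assumes "gauss_common_limit A M P Q L"
  shows "gauss_composition A M P Q = L"
  unfolding gauss_composition_def
  using assms by (auto intro!: the_equality simp: gauss_common_limit_def dest: LIMSEQ_unique)

text \<open>
  An invariant \<open>K\<close> takes the same value at every stage of the iteration, and by continuity that
  value is \<open>K L L = L\<close>. Conversely, starting the iteration one step later does not change
  its limit.
\<close>

lemma gauss_composition_iff_invariant:
  assumes lim: "\<And>P Q. P \<in> I \<Longrightarrow> Q \<in> I \<Longrightarrow> \<exists>L\<in>I. gauss_common_limit A M P Q L"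
    and inI: "\<And>P Q n. P \<in> I \<Longrightarrow> Q \<in> I \<Longrightarrow>
      fst (gauss_seq A M P Q n) \<in> I \<and> snd (gauss_seq A M P Q n) \<in> I"
    and K: "continuous_mean_on I K" "\<And>P. P \<in> I \<Longrightarrow> K P P = P"
  shows "(\<forall>P\<in>I. \<forall>Q\<in>I. K (A P Q) (M P Q) = K P Q) \<longleftrightarrow>
      (\<forall>P\<in>I. \<forall>Q\<in>I. gauss_composition A M P Q = K P Q)"
proof (intro iffI ballI)
  fix P Q assume inv: "\<forall>P\<in>I. \<forall>Q\<in>I. K (A P Q) (M P Q) = K P Q" and PQ: "P \<in> I" "Q \<in> I"
  obtain L where L: "L \<in> I" "gauss_common_limit A M P Q L"
    using lim[OF PQ] by blast
  let ?s = "\<lambda>n. (fst (gauss_seq A M P Q n), snd (gauss_seq A M P Q n))"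
  have const: "K (fst (gauss_seq A M P Q n)) (snd (gauss_seq A M P Q n)) = K P Q" for n
    by (induction n) (use inv inI[OF PQ] in auto)
  have "?s \<longlonglongrightarrow> (L, L)"
    using L(2) unfolding gauss_common_limit_def by (intro tendsto_Pair) auto
  from continuous_on_tendsto_compose[OF K(1)[unfolded continuous_mean_on_def] this]
  have "(\<lambda>n. K (fst (gauss_seq A M P Q n)) (snd (gauss_seq A M P Q n))) \<longlonglongrightarrow> K L L"
    using inI[OF PQ] L(1) by (simp add: case_prod_unfold mem_Times_iff)
  then have "K P Q = L"
    using K(2)[OF L(1)] const by (simp add: LIMSEQ_const_iff)
  then show "gauss_composition A M P Q = K P Q"
    using gauss_composition_eqI[OF L(2)] by simp
next
  fix P Q assume comp: "\<forall>P\<in>I. \<forall>Q\<in>I. gauss_composition A M P Q = K P Q" and PQ: "P \<in> I" "Q \<in> I"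
  obtain L where L: "L \<in> I" "gauss_common_limit A M P Q L"
    using lim[OF PQ] by blast
  have "A P Q \<in> I" "M P Q \<in> I"
    using inI[OF PQ, of 1] by auto
  moreover have "gauss_common_limit A M (A P Q) (M P Q) L"
    using L(2)[unfolded gauss_common_limit_def, THEN conjunct1, THEN LIMSEQ_Suc]
      L(2)[unfolded gauss_common_limit_def, THEN conjunct2, THEN LIMSEQ_Suc]
    unfolding gauss_common_limit_def gauss_seq_shift by (rule conjI)
  ultimately show "K (A P Q) (M P Q) = K P Q"
    using comp PQ gauss_composition_eqI[OF L(2)] gauss_composition_eqI by metis
qed

section \<open>Invariance forces the reciprocal density to be affine\<close>

text \<open>
  The derivative in \<open>P\<close> of the invariance equation. By implicit differentiation of
  \<open>2 u(M) = u(P) + u(Q)\<close>, the mean has partial derivative \<open>r(P)\<^sup>2 / (2 r(M)\<^sup>2)\<close>.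
\<close>

lemma invariance_derivative:
  fixes r :: "real \<Rightarrow> real"
  assumes I: "open I" "is_interval I" and pos: "\<And>x. x \<in> I \<Longrightarrow> 0 < r x"
    and s: "\<And>x. x \<in> I \<Longrightarrow> (s has_real_derivative r x) (at x)"
    and u: "\<And>x. x \<in> I \<Longrightarrow> (u has_real_derivative (r x)\<^sup>2) (at x)"
    and M: "quasi_arithmetic_on I u M"
    and inv: "\<And>P Q. P \<in> I \<Longrightarrow> Q \<in> I \<Longrightarrow> s ((P + Q) / 2) + s (M P Q) = s P + s Q"
    and PQ: "P \<in> I" "Q \<in> I"
  shows "r ((P + Q) / 2) / 2 + (r P)\<^sup>2 / (2 * r (M P Q)) = r P"
proof -
  let ?g = "inv_into I u"
  have pos2: "\<And>x. x \<in> I \<Longrightarrow> 0 < (r x)\<^sup>2" using pos by (simp add: less_imp_neq[symmetric])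
  have inj: "inj_on u I"
    using pos_deriv_strict_mono_on[OF I(2) u pos2] strict_mono_on_imp_inj_on by blast
  have M': "M P Q \<in> I" "u (M P Q) = (u P + u Q) / 2" if "P \<in> I" "Q \<in> I" for P Q
    using M that unfolding quasi_arithmetic_on_def by auto
  have eq: "M P Q = ?g ((u P + u Q) / 2)" if "P \<in> I" "Q \<in> I" for P Q
    using M'[OF that] inj by (metis inv_into_f_f)
  define m where "m = M P Q"
  have m: "m \<in> I" "u m = (u P + u Q) / 2" unfolding m_def using M'[OF PQ] by auto
  have AI: "(P + Q) / 2 \<in> I"
    using PQ affine_combination_in_image[OF I(2), of "\<lambda>x. x" P Q "1/2"]
    by (simp add: field_simps)
  have "((\<lambda>p. (u p + u Q) / 2) has_real_derivative (r P)\<^sup>2 / 2) (at P)"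
    using u[OF PQ(1)] by (auto intro!: derivative_eq_intros)
  moreover have "(?g has_real_derivative inverse ((r m)\<^sup>2)) (at ((u P + u Q) / 2))"
    using inv_into_has_derivative[OF I u pos2 m(1)] m(2) by simp
  ultimately have "((\<lambda>p. ?g ((u p + u Q) / 2)) has_real_derivative inverse ((r m)\<^sup>2) * ((r P)\<^sup>2 / 2)) (at P)"
    by (intro DERIV_chain2)
  then have "((\<lambda>p. M p Q) has_real_derivative inverse ((r m)\<^sup>2) * ((r P)\<^sup>2 / 2)) (at P)"
    by (rule has_field_derivative_transform_within_open[OF _ I(1) PQ(1)]) (use eq PQ in auto)
  then have dM: "((\<lambda>p. s (M p Q)) has_real_derivative r m * (inverse ((r m)\<^sup>2) * ((r P)\<^sup>2 / 2))) (at P)"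
    using DERIV_chain2[of s "r m" "\<lambda>p. M p Q" P] s[OF m(1)] unfolding m_def by blast
  have "((\<lambda>p. (p + Q) / 2) has_real_derivative 1 / 2) (at P)"
    by (auto intro!: derivative_eq_intros)
  then have dA: "((\<lambda>p. s ((p + Q) / 2)) has_real_derivative r ((P + Q) / 2) * (1 / 2)) (at P)"
    by (rule DERIV_chain2[of s _ "\<lambda>p. (p + Q) / 2", OF s[OF AI]])
  have "((\<lambda>p. s p + s Q) has_real_derivative r P) (at P)"
    using s[OF PQ(1)] by (auto intro!: derivative_eq_intros)
  moreover have "((\<lambda>p. s p + s Q) has_real_derivative
      r ((P + Q) / 2) * (1 / 2) + r m * (inverse ((r m)\<^sup>2) * ((r P)\<^sup>2 / 2))) (at P)"
    using DERIV_add[OF dA dM]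
    by (rule has_field_derivative_transform_within_open[OF _ I(1) PQ(1)]) (use inv PQ in auto)
  ultimately have "r P = r ((P + Q) / 2) * (1 / 2) + r m * (inverse ((r m)\<^sup>2) * ((r P)\<^sup>2 / 2))"
    by (rule DERIV_unique)
  then show ?thesis
    using pos[OF m(1)] unfolding m_def[symmetric]
    by (simp add: power2_eq_square field_simps)
qed

text \<open>
  The condition \<open>f P \<noteq> f Q\<close> is open, so the midpoint equation may be differentiated there:
  \<open>f' P = f' ((P + Q) / 2) = f' Q\<close> whenever \<open>f P \<noteq> f Q\<close>. If \<open>f'\<close> is nonzero at \<open>x\<close>, then \<open>f\<close>
  is not constant, and a point \<open>z\<close> with \<open>f z \<noteq> f x\<close> transfers \<open>f' x\<close> to those \<open>y\<close> with
  \<open>f y = f x\<close> as well; hence \<open>f'\<close> is constant.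
\<close>

lemma conditional_midpoint_affine:
  fixes f f' :: "real \<Rightarrow> real"
  assumes I: "open I" "is_interval I"
    and f: "\<And>x. x \<in> I \<Longrightarrow> (f has_real_derivative f' x) (at x)"
    and mid: "\<And>P Q. P \<in> I \<Longrightarrow> Q \<in> I \<Longrightarrow> f P \<noteq> f Q \<Longrightarrow> f ((P + Q) / 2) = (f P + f Q) / 2"
  shows "\<exists>\<alpha> \<beta>. \<forall>x\<in>I. f x = \<alpha> * x + \<beta>"
proof -
  have half: "f' P = f' ((P + Q) / 2)" if PQ: "P \<in> I" "Q \<in> I" "f P \<noteq> f Q" for P Q
  proof -
    have AI: "(P + Q) / 2 \<in> I"
      using PQ affine_combination_in_image[OF I(2), of "\<lambda>x. x" P Q "1/2"]
      by (simp add: field_simps)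
    have "((\<lambda>p. (p + Q) / 2) has_real_derivative 1 / 2) (at P)"
      by (auto intro!: derivative_eq_intros)
    then have dA: "((\<lambda>p. f ((p + Q) / 2)) has_real_derivative f' ((P + Q) / 2) * (1 / 2)) (at P)"
      by (rule DERIV_chain2[of f _ "\<lambda>p. (p + Q) / 2", OF f[OF AI]])
    \<comment> \<open>Multiplying by \<open>f p - f Q\<close> makes the midpoint equation hold for every \<open>p\<close> in \<open>I\<close>.\<close>
    have "((\<lambda>p. (f p - f Q) * (f p + f Q - 2 * f ((p + Q) / 2))) has_real_derivative
        (f P - f Q) * (f' P - f' ((P + Q) / 2))) (at P)"
      using f[OF PQ(1)] dA mid[OF PQ] by (auto intro!: derivative_eq_intros simp: algebra_simps)
    moreover have "((\<lambda>p. (f p - f Q) * (f p + f Q - 2 * f ((p + Q) / 2))) has_real_derivative 0) (at P)"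
      by (rule has_field_derivative_transform_within_open[OF DERIV_const[of 0] I(1) PQ(1)])
        (use mid PQ(2) in force)
    ultimately have "(f P - f Q) * (f' P - f' ((P + Q) / 2)) = 0"
      by (rule DERIV_unique)
    then show ?thesis using PQ(3) by simp
  qed
  have same: "f' P = f' Q" if "P \<in> I" "Q \<in> I" "f P \<noteq> f Q" for P Q
    using half[OF that] half[OF that(2,1)] that by (simp add: add.commute)
  have const: "f' y = f' x" if x: "x \<in> I" "f' x \<noteq> 0" and y: "y \<in> I" for x y
  proof (cases "f y = f x")
    case True
    have "\<exists>z\<in>I. f z \<noteq> f x"
    proof (rule ccontr)
      assume "\<not> ?thesis"
      then have "(f has_real_derivative 0) (at x)"
        by (intro has_field_derivative_transform_within_open[OF DERIV_const[of "f x"] I(1) x(1)]) auto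
      then show False using DERIV_unique[OF f[OF x(1)]] x(2) by blast
    qed
    then obtain z where "z \<in> I" "f z \<noteq> f x" by blast
    then show ?thesis using same[of y z] same[of x z] True x y by metis
  next
    case False
    show ?thesis by (rule same[OF y x(1) False])
  qed
  obtain \<alpha> where \<alpha>: "\<And>x. x \<in> I \<Longrightarrow> f' x = \<alpha>"
  proof (cases "\<exists>x\<in>I. f' x \<noteq> 0")
    case True
    then obtain x where x: "x \<in> I" "f' x \<noteq> 0" by blast
    show ?thesis by (rule that[OF const[OF x]])
  next
    case False
    show ?thesis by (rule that[of 0]) (use False in blast)
  qed
  have const': "((\<lambda>x. f x - \<alpha> * x) has_real_derivative 0) (at x within I)" if "x \<in> I" for x
    using DERIV_diff[OF f[OF that] DERIV_cmult_Id[of \<alpha>]] \<alpha>[OF that]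
    by (simp add: has_field_derivative_at_within)
  have "convex I" using I(2) is_interval_convex_1 by blast
  from has_field_derivative_zero_constant[OF this const']
  obtain \<beta> where "\<And>x. x \<in> I \<Longrightarrow> f x - \<alpha> * x = \<beta>" by blast
  then have "f x = \<alpha> * x + \<beta>" if "x \<in> I" for x
    using that by (metis diff_add_cancel add.commute)
  then show ?thesis by blast
qed

lemma invariance_imp_reciprocal_affine:
  fixes r r' :: "real \<Rightarrow> real"
  assumes I: "open I" "is_interval I" and pos: "\<And>x. x \<in> I \<Longrightarrow> 0 < r x"
    and r: "\<And>x. x \<in> I \<Longrightarrow> (r has_real_derivative r' x) (at x)"
    and s: "\<And>x. x \<in> I \<Longrightarrow> (s has_real_derivative r x) (at x)"
    and u: "\<And>x. x \<in> I \<Longrightarrow> (u has_real_derivative (r x)\<^sup>2) (at x)"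
    and M: "quasi_arithmetic_on I u M"
    and inv: "\<And>P Q. P \<in> I \<Longrightarrow> Q \<in> I \<Longrightarrow> s ((P + Q) / 2) + s (M P Q) = s P + s Q"
  shows "\<exists>\<alpha> \<beta>. \<forall>x\<in>I. inverse (r x) = \<alpha> * x + \<beta>"
proof (rule conditional_midpoint_affine[OF I])
  show "((\<lambda>x. inverse (r x)) has_real_derivative - (r' x / (r x)\<^sup>2)) (at x)" if "x \<in> I" for x
    using r[OF that] pos[OF that]
    by (auto intro!: derivative_eq_intros simp: field_simps power2_eq_square)
  fix P Q assume PQ: "P \<in> I" "Q \<in> I" and ne: "inverse (r P) \<noteq> inverse (r Q)"
  have inj: "inj_on u I"
    using pos_deriv_strict_mono_on[OF I(2) u] strict_mono_on_imp_inj_on pos by (metis zero_less_power)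
  have MI: "M P Q \<in> I" "M Q P \<in> I" and "u (M P Q) = (u P + u Q) / 2" "u (M Q P) = (u Q + u P) / 2"
    using M PQ unfolding quasi_arithmetic_on_def by blast+
  then have "M Q P = M P Q"
    using inj by (metis add.commute inj_on_eq_iff)
  have e1: "r ((P + Q) / 2) / 2 + (r P)\<^sup>2 / (2 * r (M P Q)) = r P"
    using invariance_derivative[OF I pos s u M inv PQ] by simp
  have e2: "r ((P + Q) / 2) / 2 + (r Q)\<^sup>2 / (2 * r (M P Q)) = r Q"
    using invariance_derivative[OF I pos s u M inv PQ(2,1)] \<open>M Q P = M P Q\<close> by (simp add: add.commute)
  define a b m k where "a = r P" and "b = r Q" and "m = r (M P Q)" and "k = r ((P + Q) / 2)"
  have p: "a > 0" "b > 0" "m > 0" using pos PQ MI by (auto simp: a_def b_def m_def)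
  have ab: "a \<noteq> b" using ne by (auto simp: a_def b_def)
  have e1: "k * m + a\<^sup>2 = 2 * a * m" and e2: "k * m + b\<^sup>2 = 2 * b * m"
    using e1 e2 p unfolding a_def[symmetric] b_def[symmetric] m_def[symmetric] k_def[symmetric]
    by (auto simp: field_simps)
  have "(a - b) * (a + b - 2 * m) = 0"
    using e1 e2 by (simp add: algebra_simps power2_eq_square)
  then have m2: "2 * m = a + b" using ab by simp
  have "k * m = a * (2 * m - a)"
    using e1 by (simp add: algebra_simps power2_eq_square)
  then have "k * m = a * b" unfolding m2 by simp
  then have "k * (a + b) = 2 * a * b"
    unfolding m2[symmetric] by simp
  moreover have "a + b \<noteq> 0" using p by simp
  ultimately have "k = 2 * a * b / (a + b)" by (metis nonzero_mult_div_cancel_right)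
  then show "inverse (r ((P + Q) / 2)) = (inverse (r P) + inverse (r Q)) / 2"
    using p unfolding a_def[symmetric] b_def[symmetric] k_def[symmetric]
    by (simp add: inverse_divide) (simp add: field_simps)
qed

section \<open>Christoffel symbols of the three connections\<close>

lemma smooth_fun_on_const: "smooth_fun_on I (\<lambda>_. c)"
proof -
  have "(deriv ^^ n) (\<lambda>_. c::real) = (\<lambda>_. if n = 0 then c else 0)" for n
    by (induction n) auto
  then show ?thesis unfolding smooth_fun_on_def by auto
qed

lemma smooth_fun_on_differentiable:
  assumes "smooth_fun_on I f" "x \<in> I"
  shows "(f has_real_derivative deriv f x) (at x)"
proof -
  have "((deriv ^^ 0) f) field_differentiable (at x)"
    using assms unfolding smooth_fun_on_def by blast
  then show ?thesis by (simp add: DERIV_deriv_iff_field_differentiable)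
qed

text \<open>Tensoriality in \<open>X\<close> and the Leibniz rule in \<open>Y\<close>, both applied to multiples of the coordinate field.\<close>

lemma connection_christoffel:
  assumes D: "affine_connection I D" and XY: "smooth_fun_on I X" "smooth_fun_on I Y" and x: "x \<in> I"
  shows "D X Y x = X x * (deriv Y x + Y x * christoffel D x)"
proof -
  note ax = D[unfolded affine_connection_def]
  have "D (\<lambda>u. X u * 1 + 0 * 1) Y x = X x * D (\<lambda>_. 1) Y x + 0 * D (\<lambda>_. 1) Y x"
    by (rule ax[THEN conjunct2, THEN conjunct1, rule_format, OF XY(1) smooth_fun_on_const
          smooth_fun_on_const smooth_fun_on_const XY(2) x])
  moreover have "D (\<lambda>_. 1) (\<lambda>u. Y u * 1) x = 1 * deriv Y x * 1 + Y x * D (\<lambda>_. 1) (\<lambda>_. 1) x"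
    by (rule ax[THEN conjunct2, THEN conjunct2, THEN conjunct2, rule_format, OF XY(2)
          smooth_fun_on_const smooth_fun_on_const x])
  ultimately show ?thesis by (simp add: christoffel_def)
qed

lemma dual_connection_christoffel:
  assumes "dual_connection I w D D'" "x \<in> I"
  shows "deriv w x = w x * (christoffel D x + christoffel D' x)"
proof -
  have "(\<lambda>_. 1) x * deriv (metric_pairing w (\<lambda>_. 1) (\<lambda>_. 1)) x =
      metric_pairing w (D (\<lambda>_. 1) (\<lambda>_. 1)) (\<lambda>_. 1) x + metric_pairing w (\<lambda>_. 1) (D' (\<lambda>_. 1) (\<lambda>_. 1)) x"
    by (rule assms(1)[unfolded dual_connection_def, THEN conjunct2, rule_format,
          OF smooth_fun_on_const smooth_fun_on_const smooth_fun_on_const assms(2)])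
  then show ?thesis
    by (simp add: metric_pairing_def christoffel_def algebra_simps)
qed

text \<open>
  The free factor \<open>k\<close>, here and in the Levi-Civita case, reflects that affine coordinates are
  unique only up to affine changes; with it, the explicit generators \<open>x\<close>, \<open>1/y\<close> and
  \<open>ln y\<close> of the two special families are covered up to sign and without normalising \<open>w\<close>.
\<close>

lemma affine_coordinate_of_dual:
  assumes metric: "riemannian_metric I w" and flat: "\<And>x. x \<in> I \<Longrightarrow> christoffel D x = 0"
    and dual: "dual_connection I w D D'" and k: "k > 0"
    and \<phi>: "\<And>x. x \<in> I \<Longrightarrow> (\<phi> has_real_derivative k * w x) (at x)"
  shows "affine_coordinate I D' \<phi> (\<lambda>x. k * w x)"
  unfolding affine_coordinate_def
proof (intro ballI conjI)
  fix x assume x: "x \<in> I"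
  show "(\<phi> has_real_derivative k * w x) (at x)" by (rule \<phi>[OF x])
  show "0 < k * w x" using metric k x unfolding riemannian_metric_def by simp
  have "(w has_real_derivative christoffel D' x * w x) (at x)"
    using smooth_fun_on_differentiable[of I w x] metric x dual_connection_christoffel[OF dual x] flat[OF x]
    unfolding riemannian_metric_def by (simp add: mult.commute)
  then show "((\<lambda>x. k * w x) has_real_derivative christoffel D' x * (k * w x)) (at x)"
    by (auto intro!: derivative_eq_intros)
qed

lemma affine_coordinate_of_levi_civita:
  assumes metric: "riemannian_metric I w" and lc: "levi_civita_connection I w D" and k: "k > 0"
    and \<phi>: "\<And>x. x \<in> I \<Longrightarrow> (\<phi> has_real_derivative k * sqrt (w x)) (at x)"
  shows "affine_coordinate I D \<phi> (\<lambda>x. k * sqrt (w x))"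
  unfolding affine_coordinate_def
proof (intro ballI conjI)
  fix x assume x: "x \<in> I"
  have w: "0 < w x" using metric x unfolding riemannian_metric_def by simp
  show "(\<phi> has_real_derivative k * sqrt (w x)) (at x)" by (rule \<phi>[OF x])
  show "0 < k * sqrt (w x)" using k w by simp
  have "dual_connection I w D D" using lc unfolding levi_civita_connection_def by blast
  then have "(w has_real_derivative w x * (2 * christoffel D x)) (at x)"
    using smooth_fun_on_differentiable[of I w x] metric x dual_connection_christoffel[of I w D D x]
    unfolding riemannian_metric_def by simp
  then have d: "((\<lambda>x. k * sqrt (w x)) has_real_derivative
      k * (w x * (2 * christoffel D x) * (inverse (sqrt (w x)) / 2))) (at x)"
    using w by (auto intro!: derivative_eq_intros)
  have "w x * inverse (sqrt (w x)) = sqrt (w x)"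
    using w by (metis divide_inverse real_div_sqrt less_imp_le)
  then have "k * (w x * (2 * christoffel D x) * (inverse (sqrt (w x)) / 2)) = christoffel D x * (k * sqrt (w x))"
    by (simp add: algebra_simps)
  with d show "((\<lambda>x. k * sqrt (w x)) has_real_derivative christoffel D x * (k * sqrt (w x))) (at x)"
    by metis
qed

section \<open>The two families of metrics\<close>

text \<open>
  With \<open>y = s (x - x0) > 0\<close>, the density \<open>w\<close> is \<open>c / y\<^sup>2\<close>, so the antiderivatives of \<open>w\<close> and
  \<open>sqrt w\<close> are, up to constants, multiples of \<open>1/y\<close> and \<open>ln y\<close>, which generate the harmonic and
  the geometric mean. The signs \<open>- s\<close> and \<open>s\<close> make these generators increasing in \<open>x\<close>.
\<close>

lemma inverse_square_means:
  fixes A M K :: "real \<Rightarrow> real \<Rightarrow> real"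
  assumes I: "is_interval I" and c: "c > 0" and x0: "x0 \<notin> I"
    and w: "\<forall>x\<in>I. w x = c / (x - x0)\<^sup>2"
    and A: "\<And>P Q. P \<in> I \<Longrightarrow> Q \<in> I \<Longrightarrow> A P Q = (P + Q) / 2"
    and M: "\<And>\<phi> k. k > 0 \<Longrightarrow> (\<And>x. x \<in> I \<Longrightarrow> (\<phi> has_real_derivative k * w x) (at x)) \<Longrightarrow>
      quasi_arithmetic_on I \<phi> M"
    and K: "\<And>\<phi> k. k > 0 \<Longrightarrow> (\<And>x. x \<in> I \<Longrightarrow> (\<phi> has_real_derivative k * sqrt (w x)) (at x)) \<Longrightarrow>
      quasi_arithmetic_on I \<phi> K"
  shows "\<exists>s\<in>{1, -1}. \<exists>y. y = (\<lambda>x. s * (x - x0)) \<and> y ` I \<subseteq> {0<..} \<and>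
         (\<forall>P\<in>I. \<forall>Q\<in>I.
            y (A P Q) = (y P + y Q) / 2 \<and>
            y (M P Q) = 2 / (inverse (y P) + inverse (y Q)) \<and>
            y (K P Q) = sqrt (y P * y Q))"
proof -
  have "(\<forall>x\<in>I. x0 < x) \<or> (\<forall>x\<in>I. x < x0)"
    using I x0 unfolding is_interval_1 by (meson less_imp_le not_le)
  then obtain s :: real where s: "s \<in> {1, -1}" "\<And>x. x \<in> I \<Longrightarrow> 0 < s * (x - x0)"
    by force
  define y where "y = (\<lambda>x. s * (x - x0))"
  have ss: "s * s = 1" using s(1) by auto
  have y: "0 < y x" if "x \<in> I" for x using s(2)[OF that] by (simp add: y_def)
  have y2: "(y x)\<^sup>2 = (x - x0)\<^sup>2" for x using s(1) by (auto simp: y_def power2_eq_square algebra_simps)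
  have dy: "(y has_real_derivative s) (at x)" for x
    unfolding y_def by (auto intro!: derivative_eq_intros)
  have "quasi_arithmetic_on I (\<lambda>x. - s * inverse (y x)) M"
  proof (rule M[of "1 / c"])
    show "((\<lambda>x. - s * inverse (y x)) has_real_derivative 1 / c * w x) (at x)" if "x \<in> I" for x
    proof -
      have "((\<lambda>x. - s * inverse (y x)) has_real_derivative (s * s) / (y x)\<^sup>2) (at x)"
        using dy[of x] y[OF that]
        by (auto intro!: derivative_eq_intros simp: power2_eq_square field_simps)
      then show ?thesis using w that c ss by (simp add: y2)
    qed
  qed (use c in simp)
  then have M': "M P Q \<in> I" "s * inverse (y (M P Q)) = s * ((inverse (y P) + inverse (y Q)) / 2)"
    if "P \<in> I" "Q \<in> I" for P Q
    using that unfolding quasi_arithmetic_on_def by (auto simp: algebra_simps)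
  have "quasi_arithmetic_on I (\<lambda>x. s * ln (y x)) K"
  proof (rule K[of "1 / sqrt c"])
    show "((\<lambda>x. s * ln (y x)) has_real_derivative 1 / sqrt c * sqrt (w x)) (at x)" if "x \<in> I" for x
    proof -
      have "((\<lambda>x. s * ln (y x)) has_real_derivative (s * s) / y x) (at x)"
        using dy[of x] y[OF that] by (auto intro!: derivative_eq_intros simp: field_simps)
      moreover have "w x = c / (y x)\<^sup>2" using w that by (simp add: y2)
      then have "sqrt (w x) = sqrt c / y x"
        using y[OF that] by (simp add: real_sqrt_divide)
      ultimately show ?thesis using c ss by simp
    qed
  qed (use c in simp)
  then have K': "K P Q \<in> I" "s * ln (y (K P Q)) = s * ((ln (y P) + ln (y Q)) / 2)"
    if "P \<in> I" "Q \<in> I" for P Q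
    using that unfolding quasi_arithmetic_on_def by (auto simp: algebra_simps)
  have "y (A P Q) = (y P + y Q) / 2 \<and> y (M P Q) = 2 / (inverse (y P) + inverse (y Q)) \<and>
      y (K P Q) = sqrt (y P * y Q)" if PQ: "P \<in> I" "Q \<in> I" for P Q
  proof (intro conjI)
    have s0: "s \<noteq> 0" using s(1) by auto
    show "y (A P Q) = (y P + y Q) / 2"
      using A[OF PQ] by (simp add: y_def field_simps)
    have "inverse (y (M P Q)) = (inverse (y P) + inverse (y Q)) / 2"
      using M'(2)[OF PQ] s0 by simp
    then show "y (M P Q) = 2 / (inverse (y P) + inverse (y Q))"
      by (metis inverse_divide inverse_inverse_eq)
    have "ln (y (K P Q)) = (ln (y P) + ln (y Q)) / 2"
      using K'(2)[OF PQ] s0 by simp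
    also have "\<dots> = ln (sqrt (y P * y Q))"
      using y[OF PQ(1)] y[OF PQ(2)] by (simp add: ln_sqrt ln_mult)
    finally show "y (K P Q) = sqrt (y P * y Q)"
      using y[OF PQ(1)] y[OF PQ(2)] y[OF K'(1)[OF PQ]] by (simp add: ln_inj_iff)
  qed
  then show ?thesis
    using s(1) y by (intro bexI[of _ s] exI[of _ y]) (auto simp: y_def)
qed

theorem theorem8p5:
  fixes I :: "real set" and w :: "real \<Rightarrow> real"
    and nabla nabla_dual nabla_g :: connection
    and A M M_g :: "real \<Rightarrow> real \<Rightarrow> real"
  assumes I: "open I" "is_interval I" "I \<noteq> {}"
    and metric: "riemannian_metric I w"
    and conn: "affine_connection I nabla"
    and affine_coord: "\<forall>x\<in>I. nabla (\<lambda>_. 1) (\<lambda>_. 1) x = 0"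
    and dual: "dual_connection I w nabla nabla_dual"
    and lc: "levi_civita_connection I w nabla_g"
    and A: "A = midpoint_mean I nabla"
    and M: "M = midpoint_mean I nabla_dual"
    and M_g: "M_g = midpoint_mean I nabla_g"
  shows
    "(\<forall>P\<in>I. \<forall>Q\<in>I. A P Q = (P + Q) / 2) \<and>
     strict_mean_on I A \<and> continuous_mean_on I A \<and>
     strict_mean_on I M \<and> continuous_mean_on I M \<and>
     (\<forall>P\<in>I. \<forall>Q\<in>I. \<exists>L\<in>I. gauss_common_limit A M P Q L) \<and>
     ((\<forall>P\<in>I. \<forall>Q\<in>I. M_g (A P Q) (M P Q) = M_g P Q) \<longleftrightarrow>
      (\<forall>P\<in>I. \<forall>Q\<in>I. gauss_composition A M P Q = M_g P Q)) \<and>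
     ((\<forall>P\<in>I. \<forall>Q\<in>I. gauss_composition A M P Q = M_g P Q) \<longleftrightarrow>
      (w constant_on I \<or>
       (\<exists>c x0. c > 0 \<and> x0 \<notin> I \<and> (\<forall>x\<in>I. w x = c / (x - x0)\<^sup>2)))) \<and>
     (w constant_on I \<longrightarrow>
      connections_agree_on I nabla nabla_g \<and>
      (\<forall>P\<in>I. \<forall>Q\<in>I. A P Q = M P Q \<and> M P Q = M_g P Q)) \<and>
     (\<forall>c x0. c > 0 \<longrightarrow> x0 \<notin> I \<longrightarrow> (\<forall>x\<in>I. w x = c / (x - x0)\<^sup>2) \<longrightarrow>
      (\<exists>s\<in>{1, -1}. \<exists>y. y = (\<lambda>x. s * (x - x0)) \<and>
         y ` I \<subseteq> {0<..} \<and>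
         (\<forall>P\<in>I. \<forall>Q\<in>I.
            y (A P Q) = (y P + y Q) / 2 \<and>
            y (M P Q) = 2 / (inverse (y P) + inverse (y Q)) \<and>
            y (M_g P Q) = sqrt (y P * y Q))))"
proof -
  have w: "0 < w x" "(w has_real_derivative deriv w x) (at x)" if "x \<in> I" for x
    using metric that smooth_fun_on_differentiable unfolding riemannian_metric_def by blast+
  have flat: "christoffel nabla x = 0" if "x \<in> I" for x
    using affine_coord that unfolding christoffel_def by blast
  have "isCont w x" if "x \<in> I" for x
    using w(2)[OF that] by (rule DERIV_isCont)
  then have cont: "isCont w x" "isCont (\<lambda>x. sqrt (w x)) x" if "x \<in> I" for x
    using that by (auto intro!: continuous_intros)
  obtain u where u: "\<And>x. x \<in> I \<Longrightarrow> (u has_real_derivative w x) (at x)"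
    using antiderivative_on_open_interval[OF I(1,2) cont(1)] by blast
  obtain s where s: "\<And>x. x \<in> I \<Longrightarrow> (s has_real_derivative sqrt (w x)) (at x)"
    using antiderivative_on_open_interval[OF I(1,2) cont(2)] by blast
  have "affine_coordinate I nabla (\<lambda>x. x) (\<lambda>_. 1)"
    unfolding affine_coordinate_def using flat by (auto intro!: derivative_eq_intros)
  from midpoint_mean_quasi_arithmetic[OF I(1,2) this]
  have qA: "quasi_arithmetic_on I (\<lambda>x. x) A" unfolding A .
  have qM: "quasi_arithmetic_on I \<phi> M"
    if "k > 0" "\<And>x. x \<in> I \<Longrightarrow> (\<phi> has_real_derivative k * w x) (at x)" for \<phi> k
    using midpoint_mean_quasi_arithmetic[OF I(1,2) affine_coordinate_of_dual[OF metric flat dual that]]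
    unfolding M .
  have qG: "quasi_arithmetic_on I \<phi> M_g"
    if "k > 0" "\<And>x. x \<in> I \<Longrightarrow> (\<phi> has_real_derivative k * sqrt (w x)) (at x)" for \<phi> k
    using midpoint_mean_quasi_arithmetic[OF I(1,2) affine_coordinate_of_levi_civita[OF metric lc that]]
    unfolding M_g .
  have qMu: "quasi_arithmetic_on I u M" using qM[of 1 u] u by simp
  have qGs: "quasi_arithmetic_on I s M_g" using qG[of 1 s] s by simp

  have AI: "A P Q \<in> I" and Aeq: "A P Q = (P + Q) / 2" if "P \<in> I" "Q \<in> I" for P Q
    using qA that unfolding quasi_arithmetic_on_def by auto
  have MI: "M P Q \<in> I" if "P \<in> I" "Q \<in> I" for P Q
    using qMu that unfolding quasi_arithmetic_on_def by auto
  have GI: "M_g P Q \<in> I" "s (M_g P Q) = (s P + s Q) / 2" if "P \<in> I" "Q \<in> I" for P Q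
    using qGs that unfolding quasi_arithmetic_on_def by auto
  have sqrt_pos: "\<And>x. x \<in> I \<Longrightarrow> 0 < sqrt (w x)" using w(1) by simp
  have s_inj: "inj_on s I"
    using pos_deriv_strict_mono_on[OF I(2) s sqrt_pos] strict_mono_on_imp_inj_on by blast

  have A_strict: "strict_mean_on I A"
    using quasi_arithmetic_strict[OF _ qA] by (simp add: strict_mono_on_def)
  have A_cont: "continuous_mean_on I A"
    by (rule quasi_arithmetic_continuous[OF I(1,2) _ _ qA, of "\<lambda>_. 1"]) auto
  have M_strict: "strict_mean_on I M"
    using quasi_arithmetic_strict[OF _ qMu] pos_deriv_strict_mono_on[OF I(2) u w(1)] by blast
  have M_cont: "continuous_mean_on I M"
    by (rule quasi_arithmetic_continuous[OF I(1,2) u w(1) qMu])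
  have G_cont: "continuous_mean_on I M_g"
    by (rule quasi_arithmetic_continuous[OF I(1,2) s sqrt_pos qGs])
  have G_idem: "M_g P P = P" if "P \<in> I" for P
    using GI[OF that that] that s_inj by (simp add: inj_on_eq_iff)
  have lim: "\<exists>L\<in>I. gauss_common_limit A M P Q L" if "P \<in> I" "Q \<in> I" for P Q
    by (rule gauss_common_limit_arithmetic(1)[OF I(2) Aeq M_strict that])
  have ab: "(\<forall>P\<in>I. \<forall>Q\<in>I. M_g (A P Q) (M P Q) = M_g P Q) \<longleftrightarrow>
      (\<forall>P\<in>I. \<forall>Q\<in>I. gauss_composition A M P Q = M_g P Q)"
    by (rule gauss_composition_iff_invariant[OF lim
          gauss_common_limit_arithmetic(2)[OF I(2) Aeq M_strict] G_cont G_idem])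

  have const: "connections_agree_on I nabla nabla_g \<and> (\<forall>P\<in>I. \<forall>Q\<in>I. A P Q = M P Q \<and> M P Q = M_g P Q)"
    if wc: "w constant_on I"
  proof
    obtain k where k: "\<And>x. x \<in> I \<Longrightarrow> w x = k"
      using wc unfolding constant_on_def by blast
    have "k > 0" using I(3) k w(1) by force
    have qM': "quasi_arithmetic_on I (\<lambda>x. x) M"
      by (rule qM[of "1 / k"]) (use k \<open>k > 0\<close> in \<open>auto intro!: derivative_eq_intros\<close>)
    have qG': "quasi_arithmetic_on I (\<lambda>x. x) M_g"
      by (rule qG[of "1 / sqrt k"]) (use k \<open>k > 0\<close> in \<open>auto intro!: derivative_eq_intros\<close>)
    have mid: "N P Q = (P + Q) / 2" if "quasi_arithmetic_on I (\<lambda>x. x) N" "P \<in> I" "Q \<in> I" for N P Q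
      using that unfolding quasi_arithmetic_on_def by blast
    show "\<forall>P\<in>I. \<forall>Q\<in>I. A P Q = M P Q \<and> M P Q = M_g P Q"
      using mid[OF qA] mid[OF qM'] mid[OF qG'] by metis
    have lc': "dual_connection I w nabla_g nabla_g"
      using lc unfolding levi_civita_connection_def by blast
    have "christoffel nabla_g x = 0" if x: "x \<in> I" for x
    proof -
      have "(w has_real_derivative 0) (at x)"
        by (rule has_field_derivative_transform_within_open[OF DERIV_const[of k] I(1) x]) (rule k[symmetric])
      then have "deriv w x = 0" by (rule DERIV_imp_deriv)
      then show ?thesis
        using dual_connection_christoffel[OF lc' x] w(1)[OF x] by simp
    qed
    moreover have "affine_connection I nabla_g"
      using lc' unfolding dual_connection_def by blast
    ultimately show "connections_agree_on I nabla nabla_g"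
      by (simp add: connections_agree_on_def connection_christoffel[OF conn]
          connection_christoffel[of I nabla_g] flat)
  qed
  have inverse_square: "\<exists>s\<in>{1, -1}. \<exists>y. y = (\<lambda>x. s * (x - x0)) \<and> y ` I \<subseteq> {0<..} \<and>
         (\<forall>P\<in>I. \<forall>Q\<in>I.
            y (A P Q) = (y P + y Q) / 2 \<and>
            y (M P Q) = 2 / (inverse (y P) + inverse (y Q)) \<and>
            y (M_g P Q) = sqrt (y P * y Q))"
    if "c > 0" "x0 \<notin> I" "\<forall>x\<in>I. w x = c / (x - x0)\<^sup>2" for c x0
    using inverse_square_means[where A = A and M = M and K = M_g, OF I(2) that Aeq qM qG] .

  have ac: "(\<forall>P\<in>I. \<forall>Q\<in>I. M_g (A P Q) (M P Q) = M_g P Q) \<longleftrightarrow>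
      (w constant_on I \<or> (\<exists>c x0. c > 0 \<and> x0 \<notin> I \<and> (\<forall>x\<in>I. w x = c / (x - x0)\<^sup>2)))"
    (is "?inv \<longleftrightarrow> _ \<or> ?sq")
  proof (intro iffI; (elim disjE)?)
    assume inv: ?inv
    have dr: "((\<lambda>x. sqrt (w x)) has_real_derivative deriv w x * (inverse (sqrt (w x)) / 2)) (at x)"
      if "x \<in> I" for x
      using w[OF that] by (auto intro!: derivative_eq_intros)
    have u': "(u has_real_derivative (sqrt (w x))\<^sup>2) (at x)" if "x \<in> I" for x
      using u[OF that] w(1)[OF that] by simp
    have s_inv: "s ((P + Q) / 2) + s (M P Q) = s P + s Q" if PQ: "P \<in> I" "Q \<in> I" for P Q
    proof -
      have "M_g (A P Q) (M P Q) = M_g P Q" using inv PQ by blast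
      then have "s (A P Q) + s (M P Q) = s P + s Q"
        using GI(2)[OF AI[OF PQ] MI[OF PQ]] GI(2)[OF PQ] by simp
      then show ?thesis unfolding Aeq[OF PQ] .
    qed
    have "\<exists>\<alpha> \<beta>. \<forall>x\<in>I. inverse (sqrt (w x)) = \<alpha> * x + \<beta>"
      by (rule invariance_imp_reciprocal_affine[OF I(1,2) sqrt_pos dr s u' qMu s_inv])
    then obtain \<alpha> \<beta> where recip: "\<And>x. x \<in> I \<Longrightarrow> inverse (sqrt (w x)) = \<alpha> * x + \<beta>"
      by blast
    have wx: "w x = 1 / (\<alpha> * x + \<beta>)\<^sup>2" if "x \<in> I" for x
      using recip[OF that, symmetric] w(1)[OF that] by (simp add: inverse_eq_divide power_divide)
    show "w constant_on I \<or> ?sq"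
    proof (cases "\<alpha> = 0")
      case True
      have "w constant_on I"
        unfolding constant_on_def by (intro exI[of _ "1 / \<beta>\<^sup>2"]) (simp add: wx True)
      then show ?thesis ..
    next
      case False
      have "- \<beta> / \<alpha> \<notin> I"
        using recip[of "- \<beta> / \<alpha>"] w(1)[of "- \<beta> / \<alpha>"] False by auto
      moreover have "w x = (1 / \<alpha>\<^sup>2) / (x - (- \<beta> / \<alpha>))\<^sup>2" if "x \<in> I" for x
      proof -
        have "\<alpha> * x + \<beta> = \<alpha> * (x - (- \<beta> / \<alpha>))" using False by (simp add: field_simps)
        then show ?thesis using wx[OF that] by (simp add: power_mult_distrib)
      qed
      moreover have "1 / \<alpha>\<^sup>2 > 0" using False by simp
      ultimately show ?thesis by blast
    qed
  next
    assume "w constant_on I"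
    then have "A P Q = M P Q" "M P Q = M_g P Q" if "P \<in> I" "Q \<in> I" for P Q
      using const that by blast+
    then show ?inv using MI G_idem by simp
  next
    assume ?sq
    then obtain c x0 where "c > 0" "x0 \<notin> I" "\<forall>x\<in>I. w x = c / (x - x0)\<^sup>2" by blast
    from inverse_square[OF this] obtain \<sigma> y where \<sigma>: "\<sigma> \<in> {1, -1::real}"
      and y: "y = (\<lambda>x. \<sigma> * (x - x0))" "y ` I \<subseteq> {0<..}"
      and f: "\<forall>P\<in>I. \<forall>Q\<in>I. y (A P Q) = (y P + y Q) / 2 \<and>
            y (M P Q) = 2 / (inverse (y P) + inverse (y Q)) \<and> y (M_g P Q) = sqrt (y P * y Q)"
      by blast
    have y_inj: "x = z" if "y x = y z" for x z
      using that \<sigma> unfolding y(1) by auto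
    show ?inv
    proof (intro ballI)
      fix P Q assume PQ: "P \<in> I" "Q \<in> I"
      have pos: "0 < y P" "0 < y Q" using y(2) PQ by auto
      have "y (A P Q) = (y P + y Q) / 2" "y (M P Q) = 2 / (inverse (y P) + inverse (y Q))"
        using f PQ by blast+
      then have "y P + y Q = 2 * y (A P Q)" "(y P + y Q) * y (M P Q) = 2 * (y P * y Q)"
        using pos by (simp_all add: field_simps)
      then have "y (A P Q) * y (M P Q) = y P * y Q"
        by simp
      moreover have "y (M_g (A P Q) (M P Q)) = sqrt (y (A P Q) * y (M P Q))"
        using f[THEN bspec, OF AI[OF PQ], THEN bspec, OF MI[OF PQ]] by (elim conjE)
      moreover have "y (M_g P Q) = sqrt (y P * y Q)"
        using f PQ by blast
      ultimately have "y (M_g (A P Q) (M P Q)) = y (M_g P Q)" by simp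
      then show "M_g (A P Q) (M P Q) = M_g P Q" by (rule y_inj)
    qed
  qed
  have bc: "(\<forall>P\<in>I. \<forall>Q\<in>I. gauss_composition A M P Q = M_g P Q) \<longleftrightarrow>
      (w constant_on I \<or> (\<exists>c x0. c > 0 \<and> x0 \<notin> I \<and> (\<forall>x\<in>I. w x = c / (x - x0)\<^sup>2)))"
    by (rule trans[OF ab[symmetric] ac])
  have arithmetic: "\<forall>P\<in>I. \<forall>Q\<in>I. A P Q = (P + Q) / 2"
    by (intro ballI Aeq)
  have limits: "\<forall>P\<in>I. \<forall>Q\<in>I. \<exists>L\<in>I. gauss_common_limit A M P Q L"
    by (intro ballI lim)
  show ?thesis
    by (intro conjI arithmetic A_strict A_cont M_strict M_cont limits ab bc impI[OF const])
      (assumption, intro allI impI inverse_square)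
qed

end
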